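(* There exists an infinite residually finite abelian group $A$ such that every finite quotient of $A$ admits an inverse ambiguous automorphism, whereas $A$ itself admits no inverse ambiguous automorphism.
   Context: A group $G$ is residually finite if the intersection of its normal subgroups of finite index is trivial; a finite quotient of $G$ is a group $G/N$ with $N$ a normal subgroup of finite index. A bijection $f$ of a group $G$ onto itself is called inverse ambiguous if $f^{-1}(x)=f(x)^{-1}$ for every $x\in G$, where $f^{-1}(x)$ is the preimage of $x$ under $f$ and $f(x)^{-1}$ is the group inverse of $f(x)$. An inverse ambiguous automorphism is a group automorphism that is inverse ambiguous; for an abelian group written additively, this means an automorphism $J$ with $J^{-1}(x)=-J(x)$ for all $x$. *)

theory Defs
  imports Complex_Main "HOL-Algebra.Coset"
begin

definition finite_index_normal :: "('a, 'b) monoid_scheme \<Rightarrow> 'a set \<Rightarrow> bool" where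
  "finite_index_normal G N \<longleftrightarrow> N \<lhd> G \<and> finite (rcosets\<^bsub>G\<^esub> N)"

(* The intersected family contains the carrier of the group G, so the intersection
   is never the empty one (which would be UNIV). *)
definition residually_finite :: "('a, 'b) monoid_scheme \<Rightarrow> bool" where
  "residually_finite G \<longleftrightarrow> group G \<and> \<Inter>{N. finite_index_normal G N} = {\<one>\<^bsub>G\<^esub>}"

(* Only the restriction of f to the carrier matters, so the preimage of x under f
   is taken with inv_into on the carrier. *)
definition inverse_ambiguous :: "('a, 'b) monoid_scheme \<Rightarrow> ('a \<Rightarrow> 'a) \<Rightarrow> bool" where
  "inverse_ambiguous G f \<longleftrightarrow>
     bij_betw f (carrier G) (carrier G) \<and>
     (\<forall>x\<in>carrier G. inv_into (carrier G) f x = inv\<^bsub>G\<^esub> (f x))"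

definition inverse_ambiguous_automorphism ::
    "('a, 'b) monoid_scheme \<Rightarrow> ('a \<Rightarrow> 'a) \<Rightarrow> bool" where
  "inverse_ambiguous_automorphism G f \<longleftrightarrow> f \<in> iso G G \<and> inverse_ambiguous G f"

end

theory Submission
  imports Defs "HOL-Algebra.Multiplicative_Group" "HOL-Number_Theory.Cong"
begin

text \<open>
  Let \<open>A\<close> be the additive group of the localisation of the integers at the prime 5. Every
  endomorphism of \<open>A\<close> is multiplication by a rational number, and an inverse ambiguous one would
  give a rational square root of \<open>-1\<close>. On the other hand every prime other than 5 is invertible on
  \<open>A\<close>, so a finite quotient of \<open>A\<close> is annihilated by some \<open>5 ^ k\<close>; since \<open>-1\<close> is a square modulo
  \<open>5 ^ k\<close>, multiplication by a square root of it is an inverse ambiguous automorphism of the quotient.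
\<close>

section \<open>Power maps, and square roots of -1 modulo powers of 5\<close>

text \<open>As \<open>c\<close> squares to -1 modulo the exponent \<open>n\<close>, taking
  \<open>c\<close>-th powers twice inverts every element. So the inverse map sends \<open>x\<close>
  to \<open>inv (x [^] c)\<close>, which is inverse ambiguity; commutativity makes the power map a
  homomorphism.\<close>

lemma (in comm_group) inverse_ambiguous_automorphism_pow:
  fixes n c :: nat
  assumes exponent: "\<And>x. x \<in> carrier G \<Longrightarrow> x [^] n = \<one>"
    and dvd: "n dvd c\<^sup>2 + 1"
  shows "inverse_ambiguous_automorphism G (\<lambda>x. x [^] c)"
proof -
  let ?f = "\<lambda>x. x [^] c"
  have ff: "?f (?f x) = inv x" if "x \<in> carrier G" for x
  proof -
    obtain t where t: "c\<^sup>2 + 1 = n * t" using dvd by blast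
    have "?f (?f x) \<otimes> x = x [^] (c\<^sup>2 + 1)"
      using that by (simp add: nat_pow_pow power2_eq_square)
    also have "\<dots> = \<one>"
      unfolding t using that by (simp add: nat_pow_pow[symmetric] exponent)
    finally show ?thesis using that by (simp add: inv_equality)
  qed
  have bij: "bij_betw ?f (carrier G) (carrier G)"
    by (rule bij_betwI[where g = "\<lambda>x. inv (?f x)"]) (auto simp: ff nat_pow_inv)
  have "inv_into (carrier G) ?f x = inv (?f x)" if "x \<in> carrier G" for x
    by (rule inv_into_f_eq)
      (use bij that in \<open>auto simp: bij_betw_def ff nat_pow_inv[symmetric]\<close>)
  then show ?thesis
    using bij
    by (auto simp: inverse_ambiguous_automorphism_def inverse_ambiguous_def iso_def hom_def
        pow_mult_distrib m_comm)
qed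

text \<open>Each fifth power gains one factor 5: if \<open>y\<close> is -1 modulo 5, then both terms
  of the factorisation of \<open>y ^ 5 + 1\<close> into \<open>y + 1\<close> and the alternating
  quartic are divisible by 5, and the first keeps its old power of 5.\<close>

lemma five_power_dvd_four_power: "(5::int) ^ Suc k dvd 4 ^ (5 ^ k) + 1"
proof (induction k)
  case (Suc k)
  define y :: int where "y = 4 ^ (5 ^ k)"
  have y: "5 ^ Suc k dvd y + 1" using Suc by (simp add: y_def)
  then have "5 dvd y + 1" by (metis dvd_mult_left power_Suc)
  then obtain s where s: "y = 5 * s - 1" by (metis add_diff_cancel_right' dvdE)
  \<comment> \<open>The quartic takes the value 5 at -1; the witness is its expansion at
    \<open>5 * s - 1\<close>, divided by 5.\<close>
  have "5 dvd y ^ 4 - y ^ 3 + y ^ 2 - y + 1"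
    by (rule dvdI[where k = "125 * s ^ 4 - 125 * s ^ 3 + 50 * s ^ 2 - 10 * s + 1"])
      (simp add: s power4_eq_xxxx power3_eq_cube power2_eq_square algebra_simps)
  with y have "5 ^ Suc k * 5 dvd (y + 1) * (y ^ 4 - y ^ 3 + y ^ 2 - y + 1)"
    by (rule mult_dvd_mono)
  also have "(y + 1) * (y ^ 4 - y ^ 3 + y ^ 2 - y + 1) = y ^ 5 + 1"
    by (simp add: algebra_simps eval_nat_numeral)
  also have "y ^ 5 = 4 ^ (5 ^ Suc k)"
    by (simp add: y_def power_mult[symmetric] mult.commute)
  finally show ?case by (simp add: mult.commute)
qed simp

text \<open>Since 4 is the square of 2, \<open>c = 2 ^ (5 ^ k)\<close> works.\<close>

corollary sqrt_minus_one_mod_five_power: "\<exists>c::nat. 5 ^ k dvd c\<^sup>2 + 1"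
proof
  have "(5::int) ^ k dvd 4 ^ (5 ^ k) + 1"
    using five_power_dvd_four_power[of k] by (meson dvd_trans le_imp_power_dvd le_SucI order_refl)
  moreover have "(4::int) ^ (5 ^ k) = (2 ^ (5 ^ k))\<^sup>2"
    by (simp add: power_mult[symmetric] mult.commute[of _ 2]) (simp add: power_mult)
  ultimately have "int (5 ^ k) dvd int ((2 ^ (5 ^ k))\<^sup>2 + 1)" by (simp add: add.commute)
  then show "5 ^ k dvd (2 ^ (5 ^ k))\<^sup>2 + (1::nat)"
    by (simp only: int_dvd_int_iff)
qed

section \<open>The localisation of the integers at a prime\<close>

text \<open>Asking for some denominator \<open>b\<close> outside the prime ideal, instead of the
  reduced one, makes closure proofs direct. Such a \<open>b\<close> is nonzero automatically, as
  \<open>p dvd 0\<close>.\<close>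

definition localized_ints :: "int \<Rightarrow> rat set" where
  "localized_ints p = {x. \<exists>b. \<not> p dvd b \<and> of_int b * x \<in> \<int>}"

definition localized_ints_group :: "int \<Rightarrow> rat monoid" where
  "localized_ints_group p = \<lparr>carrier = localized_ints p, monoid.mult = (+), one = 0\<rparr>"

lemma localized_ints_group_simps [simp]:
  "carrier (localized_ints_group p) = localized_ints p"
  "x \<otimes>\<^bsub>localized_ints_group p\<^esub> y = x + y"
  "\<one>\<^bsub>localized_ints_group p\<^esub> = 0"
  by (simp_all add: localized_ints_group_def)

context
  fixes p :: int
  assumes p: "prime p"
begin

lemma of_int_in_localized_ints [simp]: "of_int n \<in> localized_ints p"
  using p not_prime_unit unfolding localized_ints_def
  by (auto intro!: exI[of _ 1])

lemma localized_ints_add: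
  assumes "x \<in> localized_ints p" "y \<in> localized_ints p"
  shows "x + y \<in> localized_ints p"
proof -
  obtain b d where b: "\<not> p dvd b" "of_int b * x \<in> \<int>" and d: "\<not> p dvd d" "of_int d * y \<in> \<int>"
    using assms by (auto simp: localized_ints_def)
  have "of_int d * (of_int b * x) + of_int b * (of_int d * y) \<in> \<int>"
    using b d by (intro Ints_add) (simp_all add: Ints_mult)
  then have "of_int (b * d) * (x + y) \<in> \<int>" by (simp add: algebra_simps)
  moreover have "\<not> p dvd b * d" using b d p by (simp add: prime_dvd_mult_iff)
  ultimately show ?thesis unfolding localized_ints_def by blast
qed

lemma localized_ints_minus [simp]: "- x \<in> localized_ints p \<longleftrightarrow> x \<in> localized_ints p"
  by (simp add: localized_ints_def)

lemma localized_ints_of_int_mult: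
  assumes "x \<in> localized_ints p"
  shows "of_int n * x \<in> localized_ints p"
proof -
  obtain b where b: "\<not> p dvd b" "of_int b * x \<in> \<int>"
    using assms by (auto simp: localized_ints_def)
  have "of_int n * (of_int b * x) \<in> \<int>" using b by (simp add: Ints_mult)
  then show ?thesis using b(1) by (auto simp: localized_ints_def algebra_simps)
qed

text \<open>Integers prime to \<open>p\<close> act invertibly; this yields both the coset
  representatives of \<open>p ^ k\<close> times the group and the \<open>p\<close>-power exponent of
  finite quotients.\<close>

lemma localized_ints_divide:
  assumes "x \<in> localized_ints p" "\<not> p dvd u"
  shows "x / of_int u \<in> localized_ints p"
proof -
  obtain b where b: "\<not> p dvd b" "of_int b * x \<in> \<int>"
    using assms by (auto simp: localized_ints_def)
  have "u \<noteq> 0" using assms(2) by auto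
  then have "of_int (b * u) * (x / of_int u) \<in> \<int>" using b by (simp add: field_simps)
  moreover have "\<not> p dvd b * u" using b assms(2) p by (simp add: prime_dvd_mult_iff)
  ultimately show ?thesis unfolding localized_ints_def by blast
qed

lemma infinite_localized_ints: "infinite (localized_ints p)"
proof -
  have "range of_int \<subseteq> localized_ints p" by auto
  moreover have "infinite (range of_int :: rat set)"
    using infinite_UNIV_int by (simp add: finite_image_iff inj_def)
  ultimately show ?thesis by (rule infinite_super)
qed

lemma comm_group_localized_ints: "comm_group (localized_ints_group p)"
proof (rule comm_groupI)
  fix x assume "x \<in> carrier (localized_ints_group p)"
  then show "\<exists>y\<in>carrier (localized_ints_group p).
      y \<otimes>\<^bsub>localized_ints_group p\<^esub> x = \<one>\<^bsub>localized_ints_group p\<^esub>"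
    by (intro bexI[of _ "- x"]) auto
qed (use of_int_in_localized_ints[of 0] in \<open>auto simp: localized_ints_add\<close>)

interpretation L: comm_group "localized_ints_group p"
  by (rule comm_group_localized_ints)

lemma inv_localized_ints:
  "x \<in> localized_ints p \<Longrightarrow> inv\<^bsub>localized_ints_group p\<^esub> x = - x"
  by (rule L.inv_equality) auto

lemma pow_localized_ints: "x [^]\<^bsub>localized_ints_group p\<^esub> n = of_nat n * x" for n :: nat
  by (induction n) (simp_all add: algebra_simps)

section \<open>Residual finiteness\<close>

text \<open>A denominator prime to \<open>p\<close> is invertible modulo \<open>p ^ k\<close>, so
  every coset contains one of the integers from 0 to \<open>p ^ k - 1\<close>.\<close>

lemma finite_index_power_multiples:
  defines "N k \<equiv> (\<lambda>x. of_int (p ^ k) * x) ` localized_ints p"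
  shows "finite_index_normal (localized_ints_group p) (N k)"
proof -
  have sub: "subgroup (N k) (localized_ints_group p)"
  proof (rule L.subgroupI)
    fix x y assume "x \<in> N k" "y \<in> N k"
    then show "x \<otimes>\<^bsub>localized_ints_group p\<^esub> y \<in> N k"
      by (auto simp: N_def localized_ints_add distrib_left[symmetric] simp del: of_int_power)
  next
    fix x assume "x \<in> N k"
    then obtain a where a: "x = of_int (p ^ k) * a" "a \<in> localized_ints p" by (auto simp: N_def)
    then have "- x = of_int (p ^ k) * (- a)" "- a \<in> localized_ints p" by simp_all
    then show "inv\<^bsub>localized_ints_group p\<^esub> x \<in> N k"
      using a localized_ints_of_int_mult[of a "p ^ k"]
      by (metis N_def imageI inv_localized_ints)
  qed (use of_int_in_localized_ints[of 0] localized_ints_of_int_mult[of _ "p ^ k"]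
        in \<open>auto simp: N_def\<close>)
  have "N k #>\<^bsub>localized_ints_group p\<^esub> x
      \<in> (\<lambda>r. N k #>\<^bsub>localized_ints_group p\<^esub> of_int r) ` {0..<p ^ k}"
    if x: "x \<in> localized_ints p" for x
  proof -
    obtain b a where b: "\<not> p dvd b" "of_int b * x = of_int a"
      using x by (auto simp: localized_ints_def elim!: Ints_cases)
    have "coprime b (p ^ k)"
      using b(1) p by (simp add: prime_imp_coprime coprime_commute[of b])
    then obtain b' where b': "[b * b' = 1] (mod p ^ k)" using cong_solve_coprime_int by blast
    \<comment> \<open>This is the residue of the fraction \<open>x = a / b\<close> modulo
      \<open>p ^ k\<close>.\<close>
    define r where "r = (b' * a) mod p ^ k"
    have "p ^ k > 0" using p by (simp add: prime_gt_0_int)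
    then have r: "r \<in> {0..<p ^ k}" by (simp add: r_def)
    have "[b * r = b * b' * a] (mod p ^ k)"
      by (simp add: r_def cong_def mod_mult_right_eq mult.assoc)
    also have "[b * b' * a = 1 * a] (mod p ^ k)" using b' by (rule cong_scalar_right)
    finally have "p ^ k dvd b * r - a" by (simp add: cong_iff_dvd_diff)
    then obtain t where t: "b * r - a = p ^ k * t" by blast
    have "b \<noteq> 0" using b(1) by auto
    have "of_int (b * r - a) = (of_int (p ^ k * t) :: rat)" using t by simp
    then have "of_int b * (of_int r - x) = of_int (p ^ k) * of_int t"
      using b(2) by (simp add: algebra_simps)
    then have "of_int r = of_int (p ^ k) * (of_int t / of_int b) + x"
      using \<open>b \<noteq> 0\<close> by (simp add: field_simps)
    moreover have "of_int t / of_int b \<in> localized_ints p"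
      using b(1) by (simp add: localized_ints_divide)
    ultimately have "of_int r \<in> N k #>\<^bsub>localized_ints_group p\<^esub> x"
      unfolding r_coset_def N_def localized_ints_group_simps by blast
    then have "N k #>\<^bsub>localized_ints_group p\<^esub> x
        = N k #>\<^bsub>localized_ints_group p\<^esub> of_int r"
      using L.repr_independence sub x by simp
    then show ?thesis using r by blast
  qed
  then have "finite (rcosets\<^bsub>localized_ints_group p\<^esub> N k)"
    by (intro finite_subset[OF _ finite_imageI[of "{0..<p ^ k}"
            "\<lambda>r. N k #>\<^bsub>localized_ints_group p\<^esub> of_int r"]]) (auto simp: RCOSETS_def)
  then show ?thesis
    using L.subgroup_imp_normal[OF sub] by (simp add: finite_index_normal_def)
qed

text \<open>An element of the intersection is a multiple of every \<open>p ^ k\<close> within the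
  group. Clearing denominators prime to \<open>p\<close>, its numerator is divisible by all powers
  of \<open>p\<close>, hence zero.\<close>

lemma residually_finite_localized_ints: "residually_finite (localized_ints_group p)"
proof -
  let ?I = "\<Inter>{N. finite_index_normal (localized_ints_group p) N}"
  have "x = 0" if x: "x \<in> ?I" for x
  proof -
    have mem: "x \<in> (\<lambda>x. of_int (p ^ k) * x) ` localized_ints p" for k
      using x finite_index_power_multiples by blast
    then have "x \<in> localized_ints p" using mem[of 0] by auto
    then obtain b a where b: "\<not> p dvd b" "of_int b * x = of_int a"
      by (auto simp: localized_ints_def elim!: Ints_cases)
    have "p ^ k dvd a" for k
    proof -
      obtain y where y: "y \<in> localized_ints p" "x = of_int (p ^ k) * y" using mem by blast
      obtain d c where d: "\<not> p dvd d" "of_int d * y = of_int c"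
        using y(1) by (auto simp: localized_ints_def elim!: Ints_cases)
      have "of_int (d * a) = of_int d * (of_int b * x)" by (simp add: b)
      also have "\<dots> = of_int (b * p ^ k) * (of_int d * y)" by (simp add: y)
      also have "\<dots> = of_int (b * p ^ k * c)" by (simp add: d)
      finally have "d * a = b * p ^ k * c" by (simp only: of_int_eq_iff)
      then have "p ^ k dvd d * a" by simp
      moreover have "coprime (p ^ k) d" using d(1) p by (simp add: prime_imp_coprime)
      ultimately show ?thesis by (simp add: coprime_dvd_mult_right_iff)
    qed
    moreover have "\<not> is_unit p" using p not_prime_unit by blast
    ultimately have "a = 0"
      using finite_divisor_powers[of a p] by auto
    moreover have "b \<noteq> 0" using b(1) by auto
    ultimately show ?thesis using b(2) by simp
  qed
  moreover have "0 \<in> ?I"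
    using subgroup.one_closed by (force simp: finite_index_normal_def normal_def)
  ultimately show ?thesis
    using L.group_axioms by (auto simp: residually_finite_def)
qed

section \<open>Finite quotients\<close>

text \<open>Write the order of the quotient as \<open>m = p ^ k * u\<close> with \<open>u\<close>
  prime to \<open>p\<close>. Every \<open>X\<close> is a \<open>u\<close>-th power of some
  \<open>Y\<close>, so its \<open>p ^ k\<close>-th power is the \<open>m\<close>-th power of
  \<open>Y\<close>, which is trivial.\<close>

lemma finite_quotient_exponent:
  assumes N: "finite_index_normal (localized_ints_group p) N"
  obtains k where "\<And>X. X \<in> carrier (localized_ints_group p Mod N) \<Longrightarrow>
    X [^]\<^bsub>localized_ints_group p Mod N\<^esub> (nat p ^ k) = \<one>\<^bsub>localized_ints_group p Mod N\<^esub>"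
proof -
  interpret N: normal N "localized_ints_group p" using N by (simp add: finite_index_normal_def)
  interpret Q: group "localized_ints_group p Mod N" by (rule N.factorgroup_is_group)
  define m where "m = order (localized_ints_group p Mod N)"
  have fin: "finite (carrier (localized_ints_group p Mod N))"
    using N by (simp add: finite_index_normal_def FactGroup_def)
  then have "m > 0" unfolding m_def using Q.order_gt_0_iff_finite by blast
  have pn: "prime (nat p)" using p by (simp add: prime_nat_iff_prime)
  define k where "k = multiplicity (nat p) m"
  obtain u where u: "m = nat p ^ k * u" "\<not> nat p dvd u"
    using \<open>m > 0\<close> pn multiplicity_decompose'[of m "nat p"] not_prime_unit k_def \<open>m > 0\<close> by (metis less_not_refl)
  have u': "\<not> p dvd int u" "u \<noteq> 0"
    using u(2) p \<open>m > 0\<close> u(1) by (auto simp: nat_dvd_iff prime_ge_0_int)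
  show thesis
  proof
    fix X assume "X \<in> carrier (localized_ints_group p Mod N)"
    then obtain a where a: "a \<in> localized_ints p" "X = N #>\<^bsub>localized_ints_group p\<^esub> a"
      by (auto simp: FactGroup_def RCOSETS_def)
    \<comment> \<open>Division by \<open>u\<close> stays inside the localisation and gives a
      \<open>u\<close>-th root of the coset \<open>X\<close>.\<close>
    define y where "y = a / of_int (int u)"
    have y: "y \<in> localized_ints p" using a u' unfolding y_def by (intro localized_ints_divide)
    let ?Y = "N #>\<^bsub>localized_ints_group p\<^esub> y"
    have Y: "?Y \<in> carrier (localized_ints_group p Mod N)"
      using y by (auto simp: FactGroup_def RCOSETS_def)
    have "?Y [^]\<^bsub>localized_ints_group p Mod N\<^esub> u = X"
      using N.FactGroup_pow[of y u] y a u' by (simp add: pow_localized_ints y_def)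
    then have "X [^]\<^bsub>localized_ints_group p Mod N\<^esub> (nat p ^ k)
        = ?Y [^]\<^bsub>localized_ints_group p Mod N\<^esub> m"
      using Y by (auto simp: u(1) Q.nat_pow_pow mult.commute)
    also have "\<dots> = \<one>\<^bsub>localized_ints_group p Mod N\<^esub>"
      using Y unfolding m_def by (rule Q.pow_order_eq_1)
    finally show "X [^]\<^bsub>localized_ints_group p Mod N\<^esub> (nat p ^ k)
        = \<one>\<^bsub>localized_ints_group p Mod N\<^esub>" .
  qed
qed

section \<open>Absence of inverse ambiguous automorphisms\<close>

text \<open>Inverse ambiguity forces \<open>f (f x) = - x\<close>. By additivity,
  \<open>q = f 1\<close> then satisfies \<open>q * q = - 1\<close>, impossible for a
  rational.\<close>

lemma no_inverse_ambiguous_automorphism_localized_ints: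
  "\<not> inverse_ambiguous_automorphism (localized_ints_group p) f"
proof
  assume f: "inverse_ambiguous_automorphism (localized_ints_group p) f"
  then have hom: "f \<in> hom (localized_ints_group p) (localized_ints_group p)"
    and bij: "bij_betw f (localized_ints p) (localized_ints p)"
    and inv: "\<And>x. x \<in> localized_ints p \<Longrightarrow>
      inv_into (localized_ints p) f x = inv\<^bsub>localized_ints_group p\<^esub> (f x)"
    by (auto simp: inverse_ambiguous_automorphism_def inverse_ambiguous_def iso_def)
  interpret f: group_hom "localized_ints_group p" "localized_ints_group p" f
    using hom by unfold_locales
  have closed: "f x \<in> localized_ints p" if "x \<in> localized_ints p" for x
    using f.hom_closed that by simp
  have neg: "f (- x) = - f x" if "x \<in> localized_ints p" for x
    using f.hom_inv[of x] that closed by (simp add: inv_localized_ints)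
  have ff: "f (f x) = - x" if "x \<in> localized_ints p" for x
  proof -
    have "f (- f x) = f (inv_into (localized_ints p) f x)"
      using that closed by (simp add: inv inv_localized_ints)
    also have "\<dots> = x" using that bij by (simp add: bij_betw_inv_into_right)
    finally show ?thesis using neg closed that by (metis minus_minus)
  qed
  have nat: "f (of_nat n * x) = of_nat n * f x" if "x \<in> localized_ints p" for n x
    using f.hom_nat_pow[of x n] that by (simp add: pow_localized_ints)
  have int: "f (of_int n * x) = of_int n * f x" if "x \<in> localized_ints p" for n x
  proof (cases n rule: int_cases2)
    case (nonneg m)
    then show ?thesis using nat[OF that, of m] by simp
  next
    case (nonpos m)
    then show ?thesis
      using nat[OF that, of m] neg[OF localized_ints_of_int_mult[OF that, of "int m"]] by simp
  qed
  have one: "1 \<in> localized_ints p" using of_int_in_localized_ints[of 1] by simp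
  define q where "q = f 1"
  have q: "q \<in> localized_ints p" using closed one by (simp add: q_def)
  then obtain b a where b: "\<not> p dvd b" "of_int b * q = of_int a"
    by (auto simp: localized_ints_def elim!: Ints_cases)
  \<comment> \<open>Additivity only gives compatibility with integer factors, so \<open>f q\<close>
    is computed after multiplying by the denominator \<open>b\<close> of \<open>q\<close>.\<close>
  have "of_int b * (- 1) = of_int b * f q" using ff[OF one] by (simp add: q_def)
  also have "\<dots> = f (of_int a * 1)" using int[OF q, of b] b(2) by simp
  also have "\<dots> = of_int a * q" using int[OF one, of a] by (simp add: q_def)
  also have "\<dots> = of_int b * (q * q)" by (simp add: b(2)[symmetric])
  finally have "q * q = - 1"
    using b(1) mult_left_cancel[of "of_int b" "q * q" "- 1"] by fastforce
  then show False using zero_le_square[of q] by simp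
qed

end

theorem theorem5p7:
  "\<exists>A :: rat monoid.
     comm_group A \<and> infinite (carrier A) \<and> residually_finite A \<and>
     (\<forall>N. finite_index_normal A N \<longrightarrow>
        (\<exists>f. inverse_ambiguous_automorphism (A Mod N) f)) \<and>
     \<not> (\<exists>f. inverse_ambiguous_automorphism A f)"
proof (intro exI[of _ "localized_ints_group 5"] conjI allI impI)
  have p: "prime (5::int)" by simp
  show "comm_group (localized_ints_group 5)" using p by (rule comm_group_localized_ints)
  show "infinite (carrier (localized_ints_group 5))" using infinite_localized_ints[OF p] by simp
  show "residually_finite (localized_ints_group 5)"
    using p by (rule residually_finite_localized_ints)
  show "\<not> (\<exists>f. inverse_ambiguous_automorphism (localized_ints_group 5) f)"
    using no_inverse_ambiguous_automorphism_localized_ints[OF p] by blast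
  fix N assume N: "finite_index_normal (localized_ints_group 5) N"
  interpret L: comm_group "localized_ints_group 5" using p by (rule comm_group_localized_ints)
  interpret Q: comm_group "localized_ints_group 5 Mod N"
    using N by (intro L.abelian_FactGroup) (simp add: finite_index_normal_def normal_def)
  obtain k where "\<And>X. X \<in> carrier (localized_ints_group 5 Mod N) \<Longrightarrow>
      X [^]\<^bsub>localized_ints_group 5 Mod N\<^esub> (nat 5 ^ k) = \<one>\<^bsub>localized_ints_group 5 Mod N\<^esub>"
    using finite_quotient_exponent[OF p N] by blast
  \<comment> \<open>The choice of the prime 5 enters here: -1 is a square modulo each of its
    powers.\<close>
  moreover obtain c :: nat where "5 ^ k dvd c\<^sup>2 + 1" using sqrt_minus_one_mod_five_power by blast
  ultimately show "\<exists>f. inverse_ambiguous_automorphism (localized_ints_group 5 Mod N) f"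
    using Q.inverse_ambiguous_automorphism_pow[of "5 ^ k" c] by auto
qed

end
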